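(* Let $X$ be a real or complex Banach space with dual space $X^*$, let $A:\mathbb{N}\to\mathcal{B}(X)$ be a sequence, and consider the linear discrete-time system $x_{n+1}=A(n)x_n$ with associated operators $A_m^n$, $(m,n)\in\Delta$. The system is strongly exponentially stable if and only if there exist constants $B\ge1$, $b>0$ and $c\ge0$ with $0\le 2c<b$ such that $$\sum_{k=0}^{m}e^{b(m-k)}\|(A_m^k)^*x^*\|\le B e^{cm}\|x^*\|\quad\text{for all }m\in\mathbb{N}\text{ and }x^*\in X^*.$$
   Context: $\mathbb{N}=\{0,1,2,\dots\}$. $\mathcal{B}(X)$ is the Banach algebra of bounded linear operators on $X$, and $I$ is the identity operator. $\Delta$ is the set of pairs $(m,n)$ of nonnegative integers with $m\ge n$. $T$ is the set of triples $(m,n,p)$ of nonnegative integers with $(m,n)\in\Delta$ and $(n,p)\in\Delta$. For $(m,n)\in\Delta$, $A_m^n=A(m)A(m-1)\cdots A(n+1)$ if $m\ge n+1$, and $A_m^n=I$ if $m=n$. $X^*$ is the Banach space of continuous linear functionals on $X$, and $(A_m^k)^*:X^*\to X^*$ is the adjoint (dual) operator of $A_m^k$. The system is strongly exponentially stable if there are constants $N\ge1$, $\alpha>0$ and $\beta\in[0,\alpha)$ such that $\|A_m^p x\|\le N e^{-\alpha(m-n)}e^{\beta n}\|A_n^p x\|$ for all $(m,n,p)\in T$ and $x\in X$. *)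

theory Defs
  imports "HOL-Analysis.Bounded_Linear_Function"
begin

text \<open>The operator $A_m^n = A(m) A(m-1) \cdots A(n+1)$ for $m \ge n$, which is the identity for
  $m = n$.  It is only meant for $m \ge n$; the value for $m < n$ is junk.\<close>

primrec evol :: "(nat \<Rightarrow> 'a::real_normed_vector \<Rightarrow>\<^sub>L 'a) \<Rightarrow> nat \<Rightarrow> nat \<Rightarrow> 'a \<Rightarrow>\<^sub>L 'a" where
  "evol A 0 n = id_blinfun"
| "evol A (Suc m) n = (if n \<le> m then A (Suc m) o\<^sub>L evol A m n else id_blinfun)"

lemma evol_same: "evol A n n = id_blinfun"
  by (cases n) simp_all

lemma evol_Suc: "n \<le> m \<Longrightarrow> evol A (Suc m) n = A (Suc m) o\<^sub>L evol A m n"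
  by simp

definition strongly_exponentially_stable :: "(nat \<Rightarrow> 'a::real_normed_vector \<Rightarrow>\<^sub>L 'a) \<Rightarrow> bool" where
  "strongly_exponentially_stable A \<longleftrightarrow>
    (\<exists>N \<alpha> \<beta> :: real. N \<ge> 1 \<and> \<alpha> > 0 \<and> 0 \<le> \<beta> \<and> \<beta> < \<alpha> \<and>
      (\<forall>m n p x. n \<le> m \<and> p \<le> n \<longrightarrow>
        norm (evol A m p x) \<le> N * exp (- \<alpha> * (real m - real n)) * exp (\<beta> * real n) * norm (evol A n p x)))"

text \<open>A complex Banach space is given by its underlying real Banach space, of class \<open>banach\<close>,
  together with a complex scalar multiplication that extends the real one and is compatible with
  the norm.\<close>

locale complex_normed_space = vector_space scaleC
  for scaleC :: "complex \<Rightarrow> 'a::real_normed_vector \<Rightarrow> 'a" +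
  assumes scale_of_real: "scaleC (of_real r) x = r *\<^sub>R x"
    and norm_scale: "norm (scaleC z x) = norm z * norm x"

text \<open>The algebra of bounded complex-linear operators and the complex dual space.  Both carry the
  operator norm of the surrounding type of bounded real-linear maps.\<close>

definition complex_operators :: "(complex \<Rightarrow> 'a::real_normed_vector \<Rightarrow> 'a) \<Rightarrow> ('a \<Rightarrow>\<^sub>L 'a) set" where
  "complex_operators scaleC = {T :: 'a \<Rightarrow>\<^sub>L 'a. \<forall>z x. T (scaleC z x) = scaleC z (T x)}"

definition complex_dual :: "(complex \<Rightarrow> 'a::real_normed_vector \<Rightarrow> 'a) \<Rightarrow> ('a \<Rightarrow>\<^sub>L complex) set" where
  "complex_dual scaleC = {f :: 'a \<Rightarrow>\<^sub>L complex. \<forall>z x. f (scaleC z x) = z * f x}"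

text \<open>The adjoint of \<open>T\<close>, acting on functionals with values in the scalar field \<open>'k\<close>.\<close>

definition dual_op :: "('a::real_normed_vector \<Rightarrow>\<^sub>L 'a) \<Rightarrow> ('a \<Rightarrow>\<^sub>L 'k::real_normed_field) \<Rightarrow> ('a \<Rightarrow>\<^sub>L 'k)" where
  "dual_op T f = f o\<^sub>L T"

lemma evol_complex_operators:
  assumes "\<And>n. A n \<in> complex_operators scaleC"
  shows "evol A m n \<in> complex_operators scaleC"
  using assms by (induction m) (auto simp: complex_operators_def)

lemma dual_op_complex_dual:
  assumes "T \<in> complex_operators scaleC" and "f \<in> complex_dual scaleC"
  shows "dual_op T f \<in> complex_dual scaleC"
  using assms by (auto simp: complex_operators_def complex_dual_def dual_op_def)

lemma complex_normed_space_mult: "complex_normed_space ((*) :: complex \<Rightarrow> complex \<Rightarrow> complex)"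
  by unfold_locales (auto simp: algebra_simps scaleR_conv_of_real norm_mult)

end

theory Submission
  imports Defs
begin

text \<open>Taking $p = n$ shows that strong exponential stability is equivalent to the operator bounds
  $\|A_m^n\| \le N e^{-\alpha(m-n)} e^{\beta n}$. A single term of the weighted sum of adjoints gives such a
  bound with $\alpha = b - c$ and $\beta = c$, since $2c < b$ means $\beta < \alpha$. Conversely, with $c = \beta$
  the sum is dominated by $e^{\beta m}$ times a geometric series as soon as $b < \alpha + \beta$, and such
  a $b$ exists above $2\beta$. That an operator is no larger than its adjoint needs norming
  functionals. By Zorn's lemma there is a minimal sublinear functional below a given one, and
  minimality forces it to be linear; over the complex field one takes $x \mapsto g(x) - i g(ix)$
  for a real norming functional $g$.\<close>

section \<open>Norming functionals\<close>

text \<open>Homogeneity is demanded only as an inequality, which is easier to verify for infima;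
  equality is recovered in \<open>sublinear_scaleR\<close> by applying the inequality to
  \<open>inverse c\<close>.\<close>

definition sublinear :: "('a::real_vector \<Rightarrow> real) \<Rightarrow> bool" where
  "sublinear p \<longleftrightarrow> (\<forall>x y. p (x + y) \<le> p x + p y) \<and> (\<forall>c\<ge>0. \<forall>x. p (c *\<^sub>R x) \<le> c * p x)"

lemma sublinearI:
  assumes "\<And>x y. p (x + y) \<le> p x + p y" and "\<And>c x. 0 \<le> c \<Longrightarrow> p (c *\<^sub>R x) \<le> c * p x"
  shows "sublinear p"
  using assms by (simp add: sublinear_def)

lemma sublinear_add: "sublinear p \<Longrightarrow> p (x + y) \<le> p x + p y"
  by (simp add: sublinear_def)

lemma sublinear_zero:
  assumes "sublinear p"
  shows "p 0 = 0"
proof (rule antisym)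
  show "p 0 \<le> 0"
    using assms unfolding sublinear_def by (metis mult_zero_left order_refl scaleR_zero_left)
  show "0 \<le> p 0"
    using sublinear_add[OF assms, of 0 0] by simp
qed

lemma sublinear_scaleR:
  assumes "sublinear p" and "0 \<le> c"
  shows "p (c *\<^sub>R x) = c * p x"
proof (cases "c = 0")
  case True
  then show ?thesis by (simp add: sublinear_zero[OF assms(1)])
next
  case False
  then have c: "0 < c" using assms(2) by simp
  have "p (inverse c *\<^sub>R (c *\<^sub>R x)) \<le> inverse c * p (c *\<^sub>R x)"
    using assms(1) c unfolding sublinear_def by (meson inverse_nonnegative_iff_nonnegative less_imp_le)
  then have "p x \<le> inverse c * p (c *\<^sub>R x)"
    using c by simp
  then have "c * p x \<le> p (c *\<^sub>R x)"
    using c by (simp add: field_simps)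
  moreover have "p (c *\<^sub>R x) \<le> c * p x"
    using assms by (simp add: sublinear_def)
  ultimately show ?thesis by simp
qed

lemma sublinear_norm: "sublinear (norm :: 'a::real_normed_vector \<Rightarrow> real)"
  by (rule sublinearI) (simp_all add: norm_triangle_ineq)

lemma sublinear_lower_bound:
  assumes "sublinear p"
  shows "- p (- x) \<le> p x"
  using sublinear_add[OF assms, of x "- x"] sublinear_zero[OF assms] by simp

text \<open>Subadditivity is where the chain enters: of two members \<open>q\<close> and
  \<open>r\<close>, the smaller one lies below both, so the infima on the right may be taken
  independently. Boundedness below makes each infimum a genuine one.\<close>

lemma sublinear_INF_chain:
  fixes C :: "('a::real_vector \<Rightarrow> real) set"
  assumes ne: "C \<noteq> {}" and sub: "\<And>q. q \<in> C \<Longrightarrow> sublinear q"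
    and chain: "\<And>q r. q \<in> C \<Longrightarrow> r \<in> C \<Longrightarrow> q \<le> r \<or> r \<le> q"
    and bdd: "\<And>x. bdd_below ((\<lambda>q. q x) ` C)"
  shows "sublinear (\<lambda>x. INF q\<in>C. q x)"
proof (rule sublinearI)
  fix x y :: 'a
  have le: "(INF q\<in>C. q (x + y)) \<le> q x + r y" if qr: "q \<in> C" "r \<in> C" for q r
  proof -
    obtain s where s: "s \<in> C" "s \<le> q" "s \<le> r"
      using chain[OF qr] qr by blast
    have "(INF q\<in>C. q (x + y)) \<le> s (x + y)"
      by (rule cINF_lower[OF bdd s(1)])
    also have "\<dots> \<le> s x + s y"
      by (rule sublinear_add[OF sub[OF s(1)]])
    also have "\<dots> \<le> q x + r y"
      using s by (intro add_mono) (simp_all add: le_fun_def)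
    finally show ?thesis .
  qed
  \<comment> \<open>The two infima are taken one after the other, first over \<open>q\<close> with
    \<open>r\<close> fixed, then over \<open>r\<close>.\<close>
  have "(INF q\<in>C. q (x + y)) - r y \<le> (INF q\<in>C. q x)" if "r \<in> C" for r
    using le that by (intro cINF_greatest[OF ne]) (simp add: algebra_simps)
  then have "(INF q\<in>C. q (x + y)) - (INF q\<in>C. q x) \<le> (INF r\<in>C. r y)"
    by (intro cINF_greatest[OF ne]) (simp add: algebra_simps)
  then show "(INF q\<in>C. q (x + y)) \<le> (INF q\<in>C. q x) + (INF q\<in>C. q y)"
    by simp
next
  fix c :: real and x :: 'a
  assume c: "0 \<le> c"
  show "(INF q\<in>C. q (c *\<^sub>R x)) \<le> c * (INF q\<in>C. q x)"
  proof (cases "c = 0")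
    case True
    then show ?thesis
      using ne by (simp add: sublinear_zero sub)
  next
    case False
    then have c0: "0 < c" using c by simp
    have "(INF q\<in>C. q (c *\<^sub>R x)) / c \<le> q x" if "q \<in> C" for q
      using cINF_lower[OF bdd[of "c *\<^sub>R x"] that] sublinear_scaleR[OF sub[OF that] c, of x] c0
      by (simp add: field_simps)
    then have "(INF q\<in>C. q (c *\<^sub>R x)) / c \<le> (INF q\<in>C. q x)"
      by (intro cINF_greatest[OF ne])
    then show ?thesis using c0 by (simp add: field_simps)
  qed
qed

text \<open>This serves twice: at a minimal \<open>p\<close> it forces oddness, and at
  \<open>p = norm\<close> it prepares a functional that attains the norm at
  \<open>y\<close>.\<close>

lemma sublinear_decrease:
  fixes p :: "'a::real_vector \<Rightarrow> real"
  assumes p: "sublinear p"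
  obtains q where "sublinear q" "q \<le> p" "q (- y) \<le> - p y"
proof
  \<comment> \<open>the largest decrease in direction \<open>- y\<close> that subadditivity allows; \<open>t = 1\<close> gives the last claim\<close>
  define g where "g x t = p (x + t *\<^sub>R y) - t * p y" for x t
  define q where "q x = (INF t\<in>{0..}. g x t)" for x
  \<comment> \<open>Since \<open>t *\<^sub>R y\<close> is the sum of
    \<open>x + t *\<^sub>R y\<close> and \<open>- x\<close>, subadditivity bounds \<open>g x\<close>
    below uniformly in \<open>t\<close>, so the infimum is finite.\<close>
  have "- p (- x) \<le> g x t" if "0 \<le> t" for x t
    using sublinear_add[OF p, of "x + t *\<^sub>R y" "- x"] sublinear_scaleR[OF p that, of y]
    by (simp add: g_def)
  then have bdd: "bdd_below (g x ` {0..})" for x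
    by (intro bdd_belowI2[of _ "- p (- x)"]) simp
  have lower: "q x \<le> g x t" if "0 \<le> t" for x t
    unfolding q_def using that by (intro cINF_lower[OF bdd]) simp
  have greatest: "u \<le> q x" if "\<And>t. 0 \<le> t \<Longrightarrow> u \<le> g x t" for u x
    unfolding q_def using that by (intro cINF_greatest) auto
  show "sublinear q"
  proof (rule sublinearI)
    fix u v :: 'a
    \<comment> \<open>The parameters add along with the vectors; \<open>s\<close> and
      \<open>t\<close> are then minimised separately.\<close>
    have "q (u + v) \<le> g u s + g v t" if "0 \<le> s" "0 \<le> t" for s t
    proof -
      have "q (u + v) \<le> g (u + v) (s + t)" using that by (intro lower) simp
      also have "\<dots> \<le> g u s + g v t"
        using sublinear_add[OF p, of "u + s *\<^sub>R y" "v + t *\<^sub>R y"]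
        by (simp add: g_def algebra_simps)
      finally show ?thesis .
    qed
    then have "q (u + v) - g v t \<le> q u" if "0 \<le> t" for t
      using that by (intro greatest) (simp add: algebra_simps)
    then have "q (u + v) - q u \<le> q v"
      by (intro greatest) (simp add: algebra_simps)
    then show "q (u + v) \<le> q u + q v" by simp
  next
    fix c :: real and x :: 'a
    assume c: "0 \<le> c"
    show "q (c *\<^sub>R x) \<le> c * q x"
    proof (cases "c = 0")
      case True
      then show ?thesis
        using lower[of 0 0] by (simp add: g_def sublinear_zero[OF p])
    next
      case False
      then have c0: "0 < c" using c by simp
      \<comment> \<open>Scaling the vector by \<open>c\<close> is matched by scaling the parameter
        by \<open>c\<close>.\<close>
      have "q (c *\<^sub>R x) / c \<le> g x t" if "0 \<le> t" for t
      proof -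
        have "q (c *\<^sub>R x) \<le> g (c *\<^sub>R x) (c * t)" using c that by (intro lower) simp
        also have "\<dots> = c * g x t"
          using sublinear_scaleR[OF p c, of "x + t *\<^sub>R y"] by (simp add: g_def algebra_simps)
        finally show ?thesis using c0 by (simp add: field_simps)
      qed
      then have "q (c *\<^sub>R x) / c \<le> q x" by (rule greatest)
      then show ?thesis using c0 by (simp add: field_simps)
    qed
  qed
  show "q \<le> p"
    using lower[of 0] by (auto simp: le_fun_def g_def)
  show "q (- y) \<le> - p y"
    using lower[of 1 "- y"] by (simp add: g_def sublinear_zero[OF p])
qed

lemma minimal_sublinear_imp_linear:
  fixes p :: "'a::real_vector \<Rightarrow> real"
  assumes p: "sublinear p" and min: "\<And>q. sublinear q \<Longrightarrow> q \<le> p \<Longrightarrow> q = p"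
  shows "linear p"
proof -
  have odd: "p (- y) = - p y" for y
  proof -
    obtain q where "sublinear q" "q \<le> p" "q (- y) \<le> - p y"
      using sublinear_decrease[OF p] .
    then have "p (- y) \<le> - p y" using min by blast
    then show ?thesis using sublinear_lower_bound[OF p, of y] by simp
  qed
  show ?thesis
  proof (rule linearI)
    fix x y :: 'a and c :: real
    show "p (x + y) = p x + p y"
      \<comment> \<open>The second instance reads \<open>p x \<le> p (x + y) + p (- y)\<close>;
        oddness turns it into superadditivity.\<close>
      using sublinear_add[OF p, of x y] sublinear_add[OF p, of "x + y" "- y"] by (simp add: odd)
    show "p (c *\<^sub>R x) = c *\<^sub>R p x"
    proof (cases "0 \<le> c")
      case True
      then show ?thesis by (simp add: sublinear_scaleR[OF p])
    next
      case False
      then have "p ((- c) *\<^sub>R x) = (- c) * p x" by (intro sublinear_scaleR[OF p]) simp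
      then show ?thesis by (simp add: odd)
    qed
  qed
qed

section \<open>A linear functional below a sublinear one, by Zorn's lemma\<close>

lemma linear_below_sublinear:
  fixes p :: "'a::real_vector \<Rightarrow> real"
  assumes p: "sublinear p"
  obtains f where "linear f" "f \<le> p"
proof -
  define S where "S = {q. sublinear q \<and> q \<le> p}"
  \<comment> \<open>The order is reversed, so that Zorn's maximal element is pointwise minimal and
    the bound required for a chain is its infimum.\<close>
  let ?R = "relation_of (\<ge>) S"
  \<comment> \<open>One lower bound for all of \<open>S\<close>, so infima of nonempty chains are
    finite.\<close>
  have bdd: "- p (- x) \<le> q x" if "q \<in> S" for q x
  proof -
    have "- q (- x) \<le> q x" using that by (intro sublinear_lower_bound) (simp add: S_def)
    moreover have "q (- x) \<le> p (- x)" using that by (simp add: S_def le_fun_def)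
    ultimately show ?thesis by simp
  qed
  have "\<exists>m\<in>S. \<forall>q\<in>S. q \<le> m \<longrightarrow> q = m"
  proof (rule predicate_Zorn)
    show "partial_order_on S ?R"
      by (rule partial_order_on_relation_ofI) auto
    fix C assume C: "C \<in> Chains ?R"
    then have CS: "C \<subseteq> S" by (rule Chains_relation_of)
    show "\<exists>u\<in>S. \<forall>q\<in>C. u \<le> q"
    \<comment> \<open>The empty chain needs its own bound, because an infimum over the empty set of
      reals carries no information.\<close>
    proof (cases "C = {}")
      case True
      then show ?thesis using p by (auto simp: S_def)
    next
      case ne: False
      have bddC: "bdd_below ((\<lambda>q. q x) ` C)" for x
        using CS bdd by (intro bdd_belowI2[of _ "- p (- x)"]) blast
      let ?u = "\<lambda>x. INF q\<in>C. q x"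
      have "sublinear ?u"
      proof (rule sublinear_INF_chain[OF ne])
        show "q \<le> r \<or> r \<le> q" if "q \<in> C" "r \<in> C" for q r
          using C that by (auto simp: Chains_def relation_of_def)
      qed (use CS bddC in \<open>auto simp: S_def\<close>)
      moreover have le: "?u \<le> q" if "q \<in> C" for q
        using that by (auto simp: le_fun_def intro: cINF_lower[OF bddC])
      moreover have "?u \<le> p"
      proof -
        obtain q where q: "q \<in> C" using ne by blast
        then have "q \<le> p" using CS by (auto simp: S_def)
        with le[OF q] show ?thesis by (rule order_trans)
      qed
      ultimately have "?u \<in> S" by (simp add: S_def)
      with le show ?thesis by (intro bexI[of _ ?u]) blast+
    qed
  qed
  then obtain m where m: "m \<in> S" and min: "\<And>q. q \<in> S \<Longrightarrow> q \<le> m \<Longrightarrow> q = m"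
    by blast
  \<comment> \<open>Minimality within \<open>S\<close> is minimality among all sublinear
    functionals, as anything below \<open>m\<close> is also below \<open>p\<close>.\<close>
  have "linear m"
    using m min by (intro minimal_sublinear_imp_linear) (auto simp: S_def)
  with m that show thesis by (auto simp: S_def)
qed

section \<open>Norming functionals over the two scalar fields\<close>

lemma real_norming_functional:
  fixes y :: "'a::real_normed_vector"
  obtains f :: "'a \<Rightarrow>\<^sub>L real" where "norm f \<le> 1" "norm y \<le> f y"
proof -
  \<comment> \<open>The norm is lowered at \<open>- y\<close> before a linear \<open>g\<close> is
    chosen below it: then \<open>- g y = g (- y) \<le> q (- y) \<le> - norm y\<close>.\<close>
  obtain q :: "'a \<Rightarrow> real" where q: "sublinear q" "q \<le> norm" "q (- y) \<le> - norm y"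
    using sublinear_decrease[OF sublinear_norm] .
  obtain g where g: "linear g" "g \<le> q"
    using linear_below_sublinear[OF q(1)] .
  have le: "g x \<le> norm x" for x
    using g(2) q(2) by (meson le_funD order_trans)
  \<comment> \<open>A one-sided bound at \<open>x\<close> and \<open>- x\<close> is two-sided for
    linear \<open>g\<close>.\<close>
  have abs: "\<bar>g x\<bar> \<le> norm x" for x
    using le[of x] le[of "- x"] by (simp add: linear_neg[OF g(1)] abs_le_iff)
  have bl: "bounded_linear g"
    using g(1) abs by (intro linear_conv_bounded_linear[THEN iffD1] bounded_linear_intro[of g 1])
      (simp_all add: linear_add linear_cmul)
  show thesis
  proof (rule that[of "Blinfun g"])
    show "norm (Blinfun g) \<le> 1"
      using abs by (intro norm_blinfun_bound) (simp_all add: bounded_linear_Blinfun_apply[OF bl])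
    have "- g y \<le> q (- y)"
      using g(2) linear_neg[OF g(1), of y] by (metis le_funD)
    then show "norm y \<le> Blinfun g y"
      using q(3) by (simp add: bounded_linear_Blinfun_apply[OF bl])
  qed
qed

lemma (in complex_normed_space) complex_norming_functional:
  fixes y :: 'a
  obtains f :: "'a \<Rightarrow>\<^sub>L complex" where "f \<in> complex_dual scaleC" "norm f \<le> 1" "norm y \<le> norm (f y)"
proof -
  obtain g :: "'a \<Rightarrow>\<^sub>L real" where g: "norm g \<le> 1" "norm y \<le> g y"
    using real_norming_functional .
  define f where "f x = Complex (g x) (- g (scaleC \<i> x))" for x
  \<comment> \<open>Real linearity of \<open>g\<close> controls only real scalars, so complex
    scaling is reduced to those and a single multiplication by \<open>\<i>\<close>.\<close>
  have split: "scaleC z x = Re z *\<^sub>R x + Im z *\<^sub>R scaleC \<i> x" for z x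
  proof -
    have "scaleC z x = scaleC (of_real (Re z) + of_real (Im z) * \<i>) x"
      by (simp add: complex_eq[symmetric] mult.commute)
    also have "\<dots> = scaleC (of_real (Re z)) x + scaleC (of_real (Im z)) (scaleC \<i> x)"
      by (simp only: scale_left_distrib scale_scale)
    also have "\<dots> = Re z *\<^sub>R x + Im z *\<^sub>R scaleC \<i> x"
      by (simp only: scale_of_real)
    finally show ?thesis .
  qed
  have ii: "scaleC \<i> (scaleC \<i> x) = - x" for x
    by (simp add: scale_minus_left)
  have add: "f (x + x') = f x + f x'" for x x'
    by (simp add: f_def scale_right_distrib blinfun.add_right complex_eq_iff)
  have scale: "f (scaleC z x) = z * f x" for z x
  proof -
    have "scaleC \<i> (scaleC z x) = (- Im z) *\<^sub>R x + Re z *\<^sub>R scaleC \<i> x"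
      using split[of "\<i> * z" x] by simp
    then show ?thesis
      by (simp add: f_def split[of z x] blinfun.add_right blinfun.scaleR_right complex_eq_iff
          blinfun.diff_right blinfun.minus_right)
  qed
  have bound: "norm (f x) \<le> norm x" for x
  proof -
    \<comment> \<open>Rotating \<open>x\<close> by \<open>z\<close> makes the value of
      \<open>f\<close> real and equal to \<open>norm (f x)\<close>, and real values of
      \<open>f\<close> are values of \<open>g\<close>. For \<open>f x = 0\<close> this gives
      \<open>z = 0\<close>, and the estimate still holds.\<close>
    define z where "z = cnj (sgn (f x))"
    have "f (scaleC z x) = of_real (norm (f x))"
      by (simp add: scale z_def sgn_div_norm scaleR_conv_of_real complex_norm_square[symmetric]
          power2_eq_square divide_simps mult.commute)
    then have "norm (f x) = Re (f (scaleC z x))" by simp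
    also have "\<dots> = g (scaleC z x)" by (simp add: f_def)
    also have "\<dots> \<le> norm g * norm (scaleC z x)"
      using norm_blinfun[of g "scaleC z x"] by simp
    also have "\<dots> \<le> 1 * norm (scaleC z x)"
      using g(1) by (intro mult_right_mono) auto
    also have "\<dots> \<le> norm x"
      by (simp add: norm_scale z_def norm_sgn)
    finally show ?thesis .
  qed
  have bl: "bounded_linear f"
  proof (rule bounded_linear_intro[of f 1])
    show "f (r *\<^sub>R x) = r *\<^sub>R f x" for r x
      by (simp add: scale_of_real[symmetric] scale scaleR_conv_of_real)
  qed (simp_all add: add bound)
  show thesis
  proof (rule that[of "Blinfun f"])
    show "Blinfun f \<in> complex_dual scaleC"
      by (simp add: complex_dual_def bounded_linear_Blinfun_apply[OF bl] scale)
    show "norm (Blinfun f) \<le> 1"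
      using bound by (intro norm_blinfun_bound) (simp_all add: bounded_linear_Blinfun_apply[OF bl])
    have "norm y \<le> Re (f y)" using g(2) by (simp add: f_def)
    also have "\<dots> \<le> norm (f y)" by (rule complex_Re_le_cmod)
    finally show "norm y \<le> norm (Blinfun f y)"
      by (simp add: bounded_linear_Blinfun_apply[OF bl])
  qed
qed

section \<open>Operator norms compared with norms of adjoints\<close>

lemma norm_dual_op_le: "norm (dual_op T f) \<le> norm T * norm f"
  using norm_blinfun_compose[of f T] by (simp add: dual_op_def mult.commute)

text \<open>Choose \<open>f\<close> norming the vector \<open>T x\<close>; its value there is that
  of \<open>dual_op T f\<close> at \<open>x\<close>. The set \<open>D\<close> is left open so that
  it can be the whole real dual or the complex dual.\<close>

lemma norm_le_dual_op_bound:
  fixes T :: "'a::real_normed_vector \<Rightarrow>\<^sub>L 'a" and D :: "('a \<Rightarrow>\<^sub>L 'k::real_normed_field) set"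
  assumes norming: "\<And>y. \<exists>f\<in>D. norm f \<le> 1 \<and> norm y \<le> norm (blinfun_apply f y)"
    and "0 \<le> K" and bound: "\<And>f. f \<in> D \<Longrightarrow> norm (dual_op T f) \<le> K * norm f"
  shows "norm T \<le> K"
proof (rule norm_blinfun_bound[OF \<open>0 \<le> K\<close>])
  fix x
  obtain f where f: "f \<in> D" "norm f \<le> 1" "norm (T x) \<le> norm (blinfun_apply f (T x))"
    using norming by blast
  have "norm (T x) \<le> norm (dual_op T f x)"
    using f(3) by (simp add: dual_op_def)
  also have "\<dots> \<le> norm (dual_op T f) * norm x"
    by (rule norm_blinfun)
  also have "\<dots> \<le> K * norm x"
  proof (rule mult_right_mono)
    have "norm (dual_op T f) \<le> K * norm f" by (rule bound[OF f(1)])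
    also have "\<dots> \<le> K * 1" using f(2) \<open>0 \<le> K\<close> by (intro mult_left_mono) auto
    finally show "norm (dual_op T f) \<le> K" by simp
  qed simp
  finally show "norm (T x) \<le> K * norm x" .
qed

section \<open>Strong exponential stability\<close>

lemma evol_evol: "p \<le> n \<Longrightarrow> n \<le> m \<Longrightarrow> evol A m p = evol A m n o\<^sub>L evol A n p"
proof (induction m)
  case 0
  then show ?case by (auto intro: blinfun_eqI)
next
  case (Suc m)
  then show ?case
    \<comment> \<open>The induction hypothesis covers \<open>n \<le> m\<close>; for
      \<open>n = Suc m\<close> the left factor is the identity.\<close>
    by (cases "n = Suc m") (auto intro!: blinfun_eqI)
qed

text \<open>The same constants work on both sides. The operator bound gives back all triples because
  \<open>evol A m p\<close> factors through time \<open>n\<close>.\<close>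

lemma strongly_exponentially_stable_iff_norm:
  "strongly_exponentially_stable A \<longleftrightarrow>
    (\<exists>N \<alpha> \<beta> :: real. N \<ge> 1 \<and> \<alpha> > 0 \<and> 0 \<le> \<beta> \<and> \<beta> < \<alpha> \<and>
      (\<forall>m n. n \<le> m \<longrightarrow> norm (evol A m n) \<le> N * exp (- \<alpha> * (real m - real n)) * exp (\<beta> * real n)))"
proof -
  have "(\<forall>m n p x. n \<le> m \<and> p \<le> n \<longrightarrow>
        norm (evol A m p x) \<le> N * exp (- \<alpha> * (real m - real n)) * exp (\<beta> * real n) * norm (evol A n p x))
     \<longleftrightarrow> (\<forall>m n. n \<le> m \<longrightarrow> norm (evol A m n) \<le> N * exp (- \<alpha> * (real m - real n)) * exp (\<beta> * real n))"
    (is "?L \<longleftrightarrow> ?R") if "N \<ge> 1" for N \<alpha> \<beta> :: real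
  proof
    assume L: ?L
    show ?R
    proof (intro allI impI norm_blinfun_bound)
      fix m n :: nat and x assume "n \<le> m"
      then show "norm (evol A m n x) \<le> N * exp (- \<alpha> * (real m - real n)) * exp (\<beta> * real n) * norm x"
        using L[rule_format, of n m n x] by (simp add: evol_same)
    qed (use that in simp)
  next
    assume R: ?R
    show ?L
    proof (intro allI impI)
      fix m n p :: nat and x assume le: "n \<le> m \<and> p \<le> n"
      have "norm (evol A m p x) = norm (evol A m n (evol A n p x))"
        using le by (simp add: evol_evol[of p n m])
      also have "\<dots> \<le> norm (evol A m n) * norm (evol A n p x)"
        by (rule norm_blinfun)
      also have "\<dots> \<le> N * exp (- \<alpha> * (real m - real n)) * exp (\<beta> * real n) * norm (evol A n p x)"
        using R le by (intro mult_right_mono) auto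
      finally show "norm (evol A m p x) \<le> \<dots>" .
    qed
  qed
  then show ?thesis unfolding strongly_exponentially_stable_def by (intro ex_cong1 conj_cong refl)
qed

section \<open>Stability and weighted sums of adjoints\<close>

text \<open>Reversing the index yields a partial sum of the geometric series with ratio
  \<open>exp (- d) < 1\<close>, hence a bound independent of \<open>m\<close>.\<close>

lemma sum_exp_decay_le:
  fixes d :: real
  assumes "0 < d"
  shows "(\<Sum>k=0..m. exp (- d * (real m - real k))) \<le> 1 / (1 - exp (- d))"
proof -
  have "(\<Sum>k=0..m. exp (- d * (real m - real k))) = (\<Sum>k=0..m. exp (- d) ^ k)"
    by (rule sum.reindex_bij_witness[of _ "\<lambda>k. m - k" "\<lambda>k. m - k"])
      (auto simp: of_nat_diff exp_of_nat_mult[symmetric] algebra_simps)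
  also have "\<dots> \<le> (\<Sum>k. exp (- d) ^ k)"
    using assms by (intro sum_le_suminf summable_geometric) auto
  also have "\<dots> = 1 / (1 - exp (- d))"
    using assms by (intro suminf_geometric) auto
  finally show ?thesis .
qed

text \<open>The scalar field \<open>'k\<close> is generic, so one proof covers the real and complex
  cases.\<close>

lemma strongly_exponentially_stable_imp_dual_sum:
  fixes A :: "nat \<Rightarrow> 'a::real_normed_vector \<Rightarrow>\<^sub>L 'a"
  assumes "strongly_exponentially_stable A"
  shows "\<exists>B b c :: real. B \<ge> 1 \<and> b > 0 \<and> c \<ge> 0 \<and> 2 * c < b \<and>
    (\<forall>m. \<forall>f :: 'a \<Rightarrow>\<^sub>L 'k::real_normed_field.
      (\<Sum>k=0..m. exp (b * (real m - real k)) * norm (dual_op (evol A m k) f))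
        \<le> B * exp (c * real m) * norm f)"
proof -
  obtain N \<alpha> \<beta> :: real where par: "N \<ge> 1" "\<alpha> > 0" "0 \<le> \<beta>" "\<beta> < \<alpha>"
    and bound: "\<And>m n. n \<le> m \<Longrightarrow> norm (evol A m n) \<le> N * exp (- \<alpha> * (real m - real n)) * exp (\<beta> * real n)"
    using assms unfolding strongly_exponentially_stable_iff_norm by blast
  \<comment> \<open>The midpoint of \<open>2 * \<beta>\<close> and
    \<open>\<alpha> + \<beta>\<close>; this interval is nonempty since
    \<open>\<beta> < \<alpha>\<close>. Its half-length \<open>d\<close> is the decay rate left for
    the series.\<close>
  define b where "b = (\<alpha> + 3 * \<beta>) / 2"
  define d where "d = (\<alpha> - \<beta>) / 2"
  have d: "0 < d" "d = \<alpha> + \<beta> - b" using par by (auto simp: b_def d_def field_simps)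
  define B where "B = N * (1 / (1 - exp (- d)))"
  have "1 \<le> 1 / (1 - exp (- d))" using d(1) by (simp add: field_simps)
  then have B: "1 \<le> B" unfolding B_def using par(1) mult_mono[of 1 N 1 "1 / (1 - exp (- d))"] by simp
  have "(\<Sum>k=0..m. exp (b * (real m - real k)) * norm (dual_op (evol A m k) f))
        \<le> B * exp (\<beta> * real m) * norm f" for m and f :: "'a \<Rightarrow>\<^sub>L 'k"
  proof -
    have "exp (b * (real m - real k)) * norm (dual_op (evol A m k) f)
        \<le> N * exp (\<beta> * real m) * norm f * exp (- d * (real m - real k))" if "k \<le> m" for k
    proof -
      have "norm (dual_op (evol A m k) f) \<le> norm (evol A m k) * norm f"
        by (rule norm_dual_op_le)
      also have "\<dots> \<le> N * exp (- \<alpha> * (real m - real k)) * exp (\<beta> * real k) * norm f"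
        by (intro mult_right_mono bound that) simp
      finally have "exp (b * (real m - real k)) * norm (dual_op (evol A m k) f)
          \<le> exp (b * (real m - real k)) * (N * exp (- \<alpha> * (real m - real k)) * exp (\<beta> * real k) * norm f)"
        by (intro mult_left_mono) auto
      also have "\<dots> = N * norm f * exp (b * (real m - real k) + - \<alpha> * (real m - real k) + \<beta> * real k)"
        by (simp only: exp_add ac_simps)
      \<comment> \<open>Writing \<open>\<beta> * k\<close> as
        \<open>\<beta> * m - \<beta> * (m - k)\<close> moves the growth factor out of the sum over
        \<open>k\<close>.\<close>
      also have "b * (real m - real k) + - \<alpha> * (real m - real k) + \<beta> * real k
          = \<beta> * real m + - d * (real m - real k)"
        by (simp add: d(2) algebra_simps)
      finally show ?thesis by (simp only: exp_add ac_simps)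
    qed
    then have "(\<Sum>k=0..m. exp (b * (real m - real k)) * norm (dual_op (evol A m k) f))
        \<le> (\<Sum>k=0..m. N * exp (\<beta> * real m) * norm f * exp (- d * (real m - real k)))"
      by (intro sum_mono) simp
    also have "\<dots> = N * exp (\<beta> * real m) * norm f * (\<Sum>k=0..m. exp (- d * (real m - real k)))"
      by (simp only: sum_distrib_left)
    also have "\<dots> \<le> N * exp (\<beta> * real m) * norm f * (1 / (1 - exp (- d)))"
      using par(1) by (intro mult_left_mono sum_exp_decay_le d(1)) simp
    also have "\<dots> = B * exp (\<beta> * real m) * norm f"
      by (simp add: B_def)
    finally show ?thesis .
  qed
  moreover have "b > 0" "2 * \<beta> < b" using par by (auto simp: b_def)
  ultimately show ?thesis using B par(3) by blast
qed

lemma dual_sum_imp_strongly_exponentially_stable: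
  fixes A :: "nat \<Rightarrow> 'a::real_normed_vector \<Rightarrow>\<^sub>L 'a" and D :: "('a \<Rightarrow>\<^sub>L 'k::real_normed_field) set"
  assumes norming: "\<And>y. \<exists>f\<in>D. norm f \<le> 1 \<and> norm y \<le> norm (blinfun_apply f y)"
    and par: "B \<ge> 1" "c \<ge> 0" "2 * c < b"
    and bound: "\<And>m f. f \<in> D \<Longrightarrow>
      (\<Sum>k=0..m. exp (b * (real m - real k)) * norm (dual_op (evol A m k) f)) \<le> B * exp (c * real m) * norm f"
  shows "strongly_exponentially_stable A"
proof -
  have "norm (evol A m n) \<le> B * exp (- (b - c) * (real m - real n)) * exp (c * real n)"
    if "n \<le> m" for m n
  proof (rule norm_le_dual_op_bound[OF norming])
    fix f assume f: "f \<in> D"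
    \<comment> \<open>All terms are nonnegative, so the one with \<open>k = n\<close> is at most the
      sum.\<close>
    have "exp (b * (real m - real n)) * norm (dual_op (evol A m n) f)
        \<le> (\<Sum>k=0..m. exp (b * (real m - real k)) * norm (dual_op (evol A m k) f))"
      using that by (intro member_le_sum) auto
    also have "\<dots> \<le> B * exp (c * real m) * norm f"
      by (rule bound[OF f])
    finally have "exp (- b * (real m - real n)) * (exp (b * (real m - real n)) * norm (dual_op (evol A m n) f))
        \<le> exp (- b * (real m - real n)) * (B * exp (c * real m) * norm f)"
      by (intro mult_left_mono) auto
    moreover have "exp (- b * (real m - real n)) * exp (b * (real m - real n)) = 1"
      by (simp add: exp_add[symmetric])
    ultimately have "norm (dual_op (evol A m n) f)
        \<le> B * norm f * exp (- b * (real m - real n) + c * real m)"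
      by (simp only: exp_add mult.assoc[symmetric] mult_1_left) (simp only: ac_simps)
    also have "- b * (real m - real n) + c * real m = - (b - c) * (real m - real n) + c * real n"
      by (simp add: algebra_simps)
    finally show "norm (dual_op (evol A m n) f)
        \<le> B * exp (- (b - c) * (real m - real n)) * exp (c * real n) * norm f"
      by (simp only: exp_add ac_simps)
  qed (use par in simp)
  \<comment> \<open>Here \<open>2 * c < b\<close> becomes the strict inequality between the new
    growth and decay rates.\<close>
  moreover have "b - c > 0" "c < b - c" using par by simp_all
  ultimately show ?thesis
    unfolding strongly_exponentially_stable_iff_norm using par by blast
qed

text \<open>Stability does not mention the scalars, so on a complex space the real and the complex
  dual conditions characterise the same property.\<close>

theorem theorem11:
  fixes A :: "nat \<Rightarrow> 'a::banach \<Rightarrow>\<^sub>L 'a"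
  shows
    "(strongly_exponentially_stable A \<longleftrightarrow>
       (\<exists>B b c :: real. B \<ge> 1 \<and> b > 0 \<and> c \<ge> 0 \<and> 2 * c < b \<and>
         (\<forall>m. \<forall>f :: 'a \<Rightarrow>\<^sub>L real.
           (\<Sum>k=0..m. exp (b * (real m - real k)) * norm (dual_op (evol A m k) f))
             \<le> B * exp (c * real m) * norm f)))
     \<and>
     (\<forall>scaleC :: complex \<Rightarrow> 'a \<Rightarrow> 'a.
       complex_normed_space scaleC \<and> (\<forall>n. A n \<in> complex_operators scaleC) \<longrightarrow>
       (strongly_exponentially_stable A \<longleftrightarrow>
         (\<exists>B b c :: real. B \<ge> 1 \<and> b > 0 \<and> c \<ge> 0 \<and> 2 * c < b \<and>
           (\<forall>m. \<forall>f \<in> complex_dual scaleC.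
             (\<Sum>k=0..m. exp (b * (real m - real k)) * norm (dual_op (evol A m k) f))
               \<le> B * exp (c * real m) * norm f))))"
proof (intro conjI allI impI iffI)
  assume "strongly_exponentially_stable A"
  then show "\<exists>B b c :: real. B \<ge> 1 \<and> b > 0 \<and> c \<ge> 0 \<and> 2 * c < b \<and>
         (\<forall>m. \<forall>f :: 'a \<Rightarrow>\<^sub>L real.
           (\<Sum>k=0..m. exp (b * (real m - real k)) * norm (dual_op (evol A m k) f))
             \<le> B * exp (c * real m) * norm f)"
    by (rule strongly_exponentially_stable_imp_dual_sum)
next
  have "\<exists>f\<in>(UNIV :: ('a \<Rightarrow>\<^sub>L real) set). norm f \<le> 1 \<and> norm y \<le> norm (blinfun_apply f y)" for y
    using real_norming_functional[of y] by (metis UNIV_I abs_ge_self order_trans real_norm_def)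
  note stable = dual_sum_imp_strongly_exponentially_stable[OF this]
  assume "\<exists>B b c :: real. B \<ge> 1 \<and> b > 0 \<and> c \<ge> 0 \<and> 2 * c < b \<and>
         (\<forall>m. \<forall>f :: 'a \<Rightarrow>\<^sub>L real.
           (\<Sum>k=0..m. exp (b * (real m - real k)) * norm (dual_op (evol A m k) f))
             \<le> B * exp (c * real m) * norm f)"
  then show "strongly_exponentially_stable A"
    by (elim exE conjE) (rule stable, auto)
next
  fix scaleC :: "complex \<Rightarrow> 'a \<Rightarrow> 'a"
  assume "strongly_exponentially_stable A"
  \<comment> \<open>The estimate holds for all bounded real-linear maps into the complex numbers, in
    particular on the complex dual.\<close>
  from strongly_exponentially_stable_imp_dual_sum[OF this, where 'k = complex]
  show "\<exists>B b c :: real. B \<ge> 1 \<and> b > 0 \<and> c \<ge> 0 \<and> 2 * c < b \<and>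
           (\<forall>m. \<forall>f \<in> complex_dual scaleC.
             (\<Sum>k=0..m. exp (b * (real m - real k)) * norm (dual_op (evol A m k) f))
               \<le> B * exp (c * real m) * norm f)"
    by blast
next
  fix scaleC :: "complex \<Rightarrow> 'a \<Rightarrow> 'a"
  assume "complex_normed_space scaleC \<and> (\<forall>n. A n \<in> complex_operators scaleC)"
  then interpret complex_normed_space scaleC by simp
  have "\<exists>f\<in>complex_dual scaleC. norm f \<le> 1 \<and> norm y \<le> norm (blinfun_apply f y)" for y
    using complex_norming_functional[of y] by metis
  note stable = dual_sum_imp_strongly_exponentially_stable[OF this]
  assume "\<exists>B b c :: real. B \<ge> 1 \<and> b > 0 \<and> c \<ge> 0 \<and> 2 * c < b \<and>
           (\<forall>m. \<forall>f \<in> complex_dual scaleC.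
             (\<Sum>k=0..m. exp (b * (real m - real k)) * norm (dual_op (evol A m k) f))
               \<le> B * exp (c * real m) * norm f)"
  then show "strongly_exponentially_stable A"
    by (elim exE conjE) (rule stable, auto)
qed

end
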